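(* Let $q$ be an odd prime power. Let $B\subset\mathbb{F}_q^2$ be a Besicovitch set, and choose $b_i\in\mathbb{F}_q$ for each $i\in\mathbb{F}_q\cup\{\infty\}$ with $\ell(i,b_i)\subset B$. For $P\in\mathbb{F}_q^2$ let $m_P$ be the number of indices $i\in\mathbb{F}_q\cup\{\infty\}$ with $P\in\ell(i,b_i)$. Then \[ \sum_{P \in B} \frac{(m_P-1)(m_P-2)}{2} \geq \frac{q}{3}. \]
   Context: $\mathbb{F}_q$ is the finite field with $q$ elements. For $m,b\in\mathbb{F}_q$, $\ell(m,b)$ denotes the line $\{(x,y)\in\mathbb{F}_q^2 : y=mx+b\}$, and for $a\in\mathbb{F}_q$, $\ell(\infty,a)$ denotes the vertical line $\{(x,y): x=a\}$. A Besicovitch set in $\mathbb{F}_q^2$ is a set $B\subset\mathbb{F}_q^2$ such that for each $i\in\mathbb{F}_q\cup\{\infty\}$ there exists $b_i\in\mathbb{F}_q$ with $\ell(i,b_i)\subset B$. *)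

theory Defs
  imports Complex_Main "HOL-Library.Cardinality" "HOL-Number_Theory.Prime_Powers"
begin

text \<open>
  The index set \<open>F\<^sub>q \<union> {\<infinity>}\<close> is the type \<open>'a option\<close>: \<open>Some m\<close> is the finite slope \<open>m\<close>
  and \<open>None\<close> is \<open>\<infinity>\<close>.
\<close>

definition line :: "'a::field option \<Rightarrow> 'a \<Rightarrow> ('a \<times> 'a) set" where
  "line i b = (case i of Some m \<Rightarrow> {(x, y). y = m * x + b} | None \<Rightarrow> {(x, y). x = b})"

definition besicovitch :: "('a::field \<times> 'a) set \<Rightarrow> bool" where
  "besicovitch B \<longleftrightarrow> (\<forall>i. \<exists>b. line i b \<subseteq> B)"

definition mult_at :: "('a::field option \<Rightarrow> 'a) \<Rightarrow> 'a \<times> 'a \<Rightarrow> nat" where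
  "mult_at b P = card {i. P \<in> line i (b i)}"

end

theory Submission
  imports Defs "HOL-Number_Theory.Residues"
begin

text \<open>
  Call one of the \<open>q + 1\<close> lines triple-free if no point of it lies on two of the other lines.
  Two triple-free lines \<open>i\<close> and \<open>j\<close> cannot coexist: the remaining \<open>q - 1\<close> lines meet \<open>i\<close> in
  pairwise distinct points different from \<open>i \<inter> j\<close>, so the parameters of these points, measured
  from \<open>i \<inter> j\<close>, run through all of \<open>F\<^sub>q\<^sup>*\<close> and have product \<open>W = -1\<close>; the same holds on \<open>j\<close>.
  Comparing the two products factor by factor gives \<open>W = -W\<close> (Segre's argument), which is
  impossible for odd \<open>q\<close>. Hence at least \<open>q\<close> lines pass through a point of multiplicity
  at least 3, and \<open>m / 3 \<le> (m - 1) (m - 2) / 2\<close> for \<open>m \<ge> 3\<close>.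
\<close>

definition triple_free :: "('a::field option \<Rightarrow> 'a) \<Rightarrow> 'a option \<Rightarrow> bool" where
  "triple_free b i \<longleftrightarrow> (\<forall>P \<in> line i (b i). mult_at b P \<le> 2)"

lemma mem_line_simps [simp]:
  "(x, y) \<in> line (Some m) c \<longleftrightarrow> y = m * x + c"
  "(x, y) \<in> line None c \<longleftrightarrow> x = c"
  by (auto simp: line_def)

text \<open>Together with \<open>i\<close>, distinct \<open>k\<close> and \<open>l\<close> would
  give \<open>P\<close> multiplicity at least 3.\<close>

lemma triple_free_unique:
  fixes b :: "'a::{field,finite} option \<Rightarrow> 'a"
  assumes "triple_free b i" "P \<in> line i (b i)" "P \<in> line k (b k)" "P \<in> line l (b l)"
    and "k \<noteq> i" "l \<noteq> i"
  shows "k = l"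
proof (rule ccontr)
  assume "k \<noteq> l"
  then have "3 = card {i, k, l}"
    using assms by auto
  also have "\<dots> \<le> mult_at b P"
    unfolding mult_at_def using assms by (intro card_mono) auto
  finally show False
    using assms unfolding triple_free_def by force
qed

abbreviation units_prod :: "'a::{field,finite}" where
  "units_prod \<equiv> \<Prod>(UNIV - {0})"

lemma units_prod_nonzero: "(units_prod :: 'a::{field,finite}) \<noteq> 0"
  by simp

lemma prod_diff_eq_units_prod:
  fixes c :: "'a::{field,finite}"
  shows "(\<Prod>m\<in>UNIV - {c}. m - c) = units_prod"
  by (rule prod.reindex_bij_witness[where i = "\<lambda>m. m + c" and j = "\<lambda>m. m - c"]) auto

lemma prod_diff_remove:
  fixes c d :: "'a::{field,finite}"
  assumes "c \<noteq> d"
  shows "(d - c) * (\<Prod>m\<in>UNIV - {c, d}. m - c) = units_prod"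
proof -
  have "UNIV - {c} = insert d (UNIV - {c, d})"
    using assms by auto
  then show ?thesis
    using prod_diff_eq_units_prod[of c] by simp
qed

text \<open>Wilson's theorem, from the permutation \<open>a \<mapsto> (a - 1) / a\<close> of \<open>F\<^sub>q - {0, 1}\<close>.\<close>

lemma units_prod_eq: "(units_prod :: 'a::{field,finite}) = - 1"
proof -
  let ?S = "UNIV - {0, 1 :: 'a}"
  have 0: "(\<Prod>a\<in>?S. a) = units_prod"
    using prod_diff_remove[of 0 "1 :: 'a"] by simp
  have 1: "(\<Prod>a\<in>?S. a - 1) = - (units_prod :: 'a)"
    using prod_diff_remove[of 1 "0 :: 'a"] by (simp add: insert_commute minus_equation_iff)
  have "(\<Prod>a\<in>?S. a) = (\<Prod>a\<in>?S. (a - 1) / a)"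
    by (rule prod.reindex_bij_witness[where i = "\<lambda>a. (a - 1) / a" and j = "\<lambda>a. 1 / (1 - a)"])
      (auto simp: field_simps)
  also have "\<dots> = - 1"
    unfolding prod_dividef 0 1 using units_prod_nonzero[where 'a = 'a] by (simp del: prod_zero_iff)
  finally show ?thesis
    using 0 by simp
qed

text \<open>Otherwise the characteristic would be 2, and it divides the order of the field.\<close>

lemma neg_one_neq_one_of_odd_card:
  assumes "odd CARD('a::{field,finite})"
  shows "(- 1 :: 'a) \<noteq> 1"
proof
  assume "(- 1 :: 'a) = 1"
  then have "of_nat 2 = (0 :: 'a)"
    by (simp add: neg_eq_iff_add_eq_0)
  then have "CHAR('a) dvd 2"
    by (simp only: of_nat_eq_0_iff_char_dvd)
  then have "CHAR('a) = 2"
    using CHAR_not_1[where 'a = 'a] prime_nat_iff[of 2] by auto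
  then show False
    using CHAR_dvd_CARD[where 'a = 'a] assms by simp
qed

text \<open>\<open>u k\<close> is the parameter of \<open>i \<inter> k\<close> on line \<open>i\<close>, measured from \<open>(x, y) = i \<inter> j\<close>.\<close>

lemma prod_parameters:
  fixes b u :: "'a::{field,finite} option \<Rightarrow> 'a"
  assumes free: "triple_free b i" and "i \<noteq> j"
    and j: "(x, y) \<in> line j (b j)"
    and i: "\<And>t. (x + r * t, y + s * t) \<in> line i (b i)"
    and k: "\<And>k. k \<noteq> i \<Longrightarrow> k \<noteq> j \<Longrightarrow> (x + r * u k, y + s * u k) \<in> line k (b k)"
  shows "(\<Prod>k\<in>UNIV - {i, j}. u k) = units_prod"
proof -
  have inj: "inj_on u (UNIV - {i, j})"
  proof (rule inj_onI)
    fix k l assume "k \<in> UNIV - {i, j}" "l \<in> UNIV - {i, j}" "u k = u l"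
    then show "k = l"
      using triple_free_unique[OF free i[of "u k"], of k l] k[of k] k[of l] by auto
  qed
  \<comment> \<open>Parameter 0 is the point \<open>(x, y)\<close>, where \<open>j\<close> already
    meets \<open>i\<close>.\<close>
  have "u k \<noteq> 0" if "k \<in> UNIV - {i, j}" for k
    using triple_free_unique[OF free i[of 0], of k j] k[of k] j that \<open>i \<noteq> j\<close> by auto
  then have "u ` (UNIV - {i, j}) \<subseteq> UNIV - {0}"
    by auto
  \<comment> \<open>Both sides are \<open>q - 1\<close>, so the injective \<open>u\<close> hits
    every unit.\<close>
  moreover have "card (u ` (UNIV - {i, j})) = card (UNIV - {0 :: 'a})"
    using \<open>i \<noteq> j\<close> by (simp add: card_image[OF inj] card_Diff_subset)
  ultimately have "u ` (UNIV - {i, j}) = UNIV - {0}"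
    by (intro card_subset_eq) auto
  then show ?thesis
    using prod.reindex[OF inj, of "\<lambda>a. a"] by simp
qed

text \<open>With horizontal displacement as parameter on both lines, the parameters of line
  \<open>m\<close> differ only in their denominators \<open>m - i\<close> and \<open>m - j\<close>,
  whose products over \<open>m\<close> are opposite. The vertical line has the same parameter on
  both.\<close>

lemma not_triple_free_finite_slopes:
  fixes b :: "'a::{field,finite} option \<Rightarrow> 'a"
  assumes "odd CARD('a)" "i \<noteq> j" "triple_free b (Some i)" "triple_free b (Some j)"
  shows False
proof -
  define x where "x = - (b (Some i) - b (Some j)) / (i - j)"
  define y where "y = i * x + b (Some i)"
  have y': "y = j * x + b (Some j)"
    using \<open>i \<noteq> j\<close> unfolding y_def x_def by (simp add: divide_simps) (simp add: algebra_simps)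
  \<comment> \<open>Height of line \<open>m\<close> above \<open>(x, y)\<close>; solving
    \<open>y + n * t = m * (x + t) + b (Some m)\<close> for \<open>t\<close> gives
    \<open>u n (Some m)\<close>.\<close>
  define c where "c m = b (Some m) + m * x - y" for m
  define u where
    "u n k = (case k of None \<Rightarrow> b None - x | Some m \<Rightarrow> - c m / (m - n))" for n k
  have on_line: "(x + 1 * u n k, y + n * u n k) \<in> line k (b k)" if "k \<noteq> Some n" for n k
  proof (cases k)
    case (Some m)
    have "(m - n) * u n k = - c m"
      using that Some by (simp add: u_def)
    then show ?thesis
      using Some by (simp add: c_def algebra_simps)
  qed (simp add: u_def)
  have on_i: "(x + 1 * t, y + i * t) \<in> line (Some i) (b (Some i))" for t
    by (simp add: y_def algebra_simps)
  have on_j: "(x + 1 * t, y + j * t) \<in> line (Some j) (b (Some j))" for t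
    by (simp add: y' algebra_simps)
  have W: "(\<Prod>k\<in>UNIV - {Some i, Some j}. u i k) = units_prod"
    by (rule prod_parameters[OF assms(3) _ _ on_i on_line]) (use \<open>i \<noteq> j\<close> y' in auto)
  have W': "(\<Prod>k\<in>UNIV - {Some j, Some i}. u j k) = units_prod"
    by (rule prod_parameters[OF assms(4) _ _ on_j on_line]) (use \<open>i \<noteq> j\<close> y_def in auto)
  let ?S = "UNIV - {i, j}"
  have split: "UNIV - {Some i, Some j} = insert None (Some ` ?S)"
    by (auto simp: image_iff)
  have prod_u: "(\<Prod>k\<in>UNIV - {Some i, Some j}. u n k) =
      (b None - x) * ((\<Prod>m\<in>?S. - c m) / (\<Prod>m\<in>?S. m - n))" for n
    unfolding split by (subst prod.insert)
      (auto simp: prod.reindex u_def simp flip: prod_dividef simp del: times_divide_eq_right)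
  \<comment> \<open>Both sides are the product of all units.\<close>
  have "(j - i) * (\<Prod>m\<in>?S. m - i) = (i - j) * (\<Prod>m\<in>?S. m - j)"
    using prod_diff_remove[of i j] prod_diff_remove[of j i] \<open>i \<noteq> j\<close> by (simp add: insert_commute)
  then have "(i - j) * (\<Prod>m\<in>?S. m - j) = (i - j) * - (\<Prod>m\<in>?S. m - i)"
    by (simp add: algebra_simps)
  then have "(\<Prod>m\<in>?S. m - j) = - (\<Prod>m\<in>?S. m - i)"
    using \<open>i \<noteq> j\<close> by (simp del: mult_minus_right)
  then have "(units_prod :: 'a) = - units_prod"
    using W W' prod_u[of i] prod_u[of j] by (simp add: insert_commute)
  then show False
    using neg_one_neq_one_of_odd_card[OF assms(1)] by (simp add: units_prod_eq)
qed

text \<open>On the vertical line the parameter is the height \<open>c m\<close>, on line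
  \<open>j\<close> it is \<open>- c m / (m - j)\<close>. The \<open>q - 1\<close> signs cancel, so
  comparing products gives \<open>W = W / W = 1\<close>, against \<open>W = -1\<close>.\<close>

lemma not_triple_free_vertical:
  fixes b :: "'a::{field,finite} option \<Rightarrow> 'a"
  assumes "odd CARD('a)" "triple_free b None" "triple_free b (Some j)"
  shows False
proof -
  define x where "x = b None"
  define y where "y = j * x + b (Some j)"
  define c where "c m = b (Some m) + m * x - y" for m
  define u where "u k = c (the k)" for k
  define v where "v k = - c (the k) / (the k - j)" for k
  have W: "(\<Prod>k\<in>UNIV - {None, Some j}. u k) = units_prod"
    by (rule prod_parameters[where x = x and y = y and r = 0 and s = 1 and b = b])
      (use assms in \<open>auto simp: x_def y_def c_def u_def\<close>)
  have "(x + 1 * v k, y + j * v k) \<in> line k (b k)" if k_neq: "k \<noteq> Some j" "k \<noteq> None" for k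
  proof -
    obtain m where k: "k = Some m"
      using k_neq by auto
    have "(m - j) * v k = - c m"
      using k_neq k by (simp add: v_def)
    then show ?thesis
      using k by (simp add: c_def algebra_simps)
  qed
  then have W': "(\<Prod>k\<in>UNIV - {Some j, None}. v k) = units_prod"
    by (intro prod_parameters[where x = x and y = y and r = 1 and s = j and b = b])
      (use assms in \<open>auto simp: x_def y_def algebra_simps\<close>)
  let ?S = "UNIV - {j}"
  have split: "UNIV - {None, Some j} = Some ` ?S"
    by (auto simp: image_iff)
  have "even (card ?S)"
    using assms(1) by (simp add: card_Diff_subset)
  then have "(\<Prod>m\<in>?S. - c m) = (\<Prod>m\<in>?S. c m)"
    by (subst prod_uminus) simp
  then have "(units_prod :: 'a) = units_prod / units_prod"
    using W W' prod_diff_eq_units_prod[of j] unfolding insert_commute[of "Some j"] split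
    by (simp add: prod.reindex u_def v_def prod_dividef del: divide_minus_left)
  then show False
    using neg_one_neq_one_of_odd_card[OF assms(1)] by (simp add: units_prod_eq)
qed

lemma triple_free_at_most_one:
  fixes b :: "'a::{field,finite} option \<Rightarrow> 'a"
  assumes "odd CARD('a)" "triple_free b i" "triple_free b j"
  shows "i = j"
  using not_triple_free_finite_slopes[OF assms(1)] not_triple_free_vertical[OF assms(1)] assms(2,3)
  by (cases i; cases j) auto

text \<open>The difference of the two sides is \<open>(m - 3) * (3 * m - 2) / 6\<close>.\<close>

lemma third_le_choose:
  fixes m :: nat
  assumes "m \<ge> 3"
  shows "real m / 3 \<le> (real m - 1) * (real m - 2) / 2"
proof -
  have "0 \<le> (real m - 3) * (3 * real m - 2)"
    using assms by (intro mult_nonneg_nonneg) auto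
  then show ?thesis
    by (simp add: algebra_simps)
qed

text \<open>The quadratic is negative only strictly between 1 and 2.\<close>

lemma choose_nonneg:
  fixes m :: nat
  shows "0 \<le> (real m - 1) * (real m - 2) / 2"
proof (cases "m \<ge> 3")
  case False
  then have "m = 0 \<or> m = 1 \<or> m = 2"
    by auto
  then show ?thesis
    by auto
qed simp

theorem theorem1:
  fixes q :: nat
    and B :: "('a::{field,finite} \<times> 'a) set"
    and b :: "'a option \<Rightarrow> 'a"
  assumes "primepow q" and "odd q"
    and "CARD('a) = q"
    and "besicovitch B"
    and "\<And>i. line i (b i) \<subseteq> B"
  shows "(\<Sum>P\<in>B. (real (mult_at b P) - 1) * (real (mult_at b P) - 2) / 2) \<ge> real q / 3"
proof -
  let ?m = "mult_at b"
  define D where "D = {P \<in> B. ?m P \<ge> 3}"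
  have "card {i. triple_free b i} \<le> 1"
    using triple_free_at_most_one[of b] assms(2,3)
    by (subst card_le_Suc0_iff_eq[folded One_nat_def]) auto
  moreover have "{i. \<not> triple_free b i} = UNIV - {i. triple_free b i}"
    by auto
  ultimately have "q \<le> card {i. \<not> triple_free b i}"
    using assms(3) by (simp add: card_Diff_subset)
  \<comment> \<open>A line that is not triple-free contains a point of \<open>D\<close>.\<close>
  also have "\<dots> \<le> card (\<Union>P\<in>D. {i. P \<in> line i (b i)})"
  proof (rule card_mono)
    show "{i. \<not> triple_free b i} \<subseteq> (\<Union>P\<in>D. {i. P \<in> line i (b i)})"
      using assms(5) by (force simp: D_def triple_free_def not_le)
  qed simp
  also have "\<dots> \<le> (\<Sum>P\<in>D. ?m P)"
    unfolding mult_at_def by (rule card_UN_le) simp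
  finally have "real q / 3 \<le> (\<Sum>P\<in>D. real (?m P) / 3)"
    by (simp flip: sum_divide_distrib of_nat_sum)
  also have "\<dots> \<le> (\<Sum>P\<in>D. (real (?m P) - 1) * (real (?m P) - 2) / 2)"
    by (intro sum_mono third_le_choose) (simp add: D_def)
  also have "\<dots> \<le> (\<Sum>P\<in>B. (real (?m P) - 1) * (real (?m P) - 2) / 2)"
    by (intro sum_mono2 choose_nonneg) (auto simp: D_def)
  finally show ?thesis .
qed

end
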